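(* Let $n\ge1$, let $S\subseteq V(G_n)$ be nonempty, and let $\lambda,\mu$ be adjacent vertices of $G_n$. Then $|d_S(\lambda)-d_S(\mu)|\le 1$. Equivalently, exactly one of the following three cases holds: $$d_S(\mu)=d_S(\lambda)-1,\qquad d_S(\mu)=d_S(\lambda),\qquad d_S(\mu)=d_S(\lambda)+1.$$
   Context: Partition graph: for $n\ge 1$, the vertices of the simple graph $G_n$ are the partitions $\lambda=(\lambda_1\ge\dots\ge\lambda_k>0)$ of $n$. An elementary unit transfer on $\lambda=(\lambda_1,\dots,\lambda_k)$: choose distinct indices $i,j\in\{1,\dots,k\}$, replace $\lambda_i$ by $\lambda_i+1$ and $\lambda_j$ by $\lambda_j-1$, delete the latter if it becomes $0$, and reorder the parts into nonincreasing form; if the resulting partition $\mu$ satisfies $\mu\neq\lambda$, then $\mu$ is obtained from $\lambda$ by an elementary unit transfer. Two partitions $\lambda,\mu$ of $n$ are adjacent in $G_n$ if one of them is obtained from the other by a single elementary unit transfer. The graph $G_n$ is connected. For nonempty $S\subseteq V(G_n)$, $d_S(\lambda)=\min_{\sigma\in S}d_{G_n}(\lambda,\sigma)$, where $d_{G_n}$ is the graph distance. *)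

theory Defs
  imports "Graph_Theory.Digraph_Component"
begin

definition partitions :: "nat \<Rightarrow> nat list set" where
  "partitions n = {lam. sorted_wrt (\<ge>) lam \<and> (\<forall>x\<in>set lam. 0 < x) \<and> sum_list lam = n}"

(* Truncated subtraction is harmless here: the parts of a partition are positive, so
   lam ! j - 1 never truncates, and filtering removes at most the part at position j. *)
definition unit_transfer :: "nat list \<Rightarrow> nat list \<Rightarrow> bool" where
  "unit_transfer lam mu \<longleftrightarrow>
     (\<exists>i<length lam. \<exists>j<length lam. i \<noteq> j \<and>
        mu = rev (sort (filter (\<lambda>x. x \<noteq> 0) (lam[i := lam ! i + 1, j := lam ! j - 1])))) \<and>
     mu \<noteq> lam"

(* As in Graph_Theory, a simple graph is a symmetric loop-free digraph:
   an edge is represented by its two orientations. *)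
definition partition_graph :: "nat \<Rightarrow> nat list pair_pre_digraph" where
  "partition_graph n =
     \<lparr> pverts = partitions n,
       parcs = {(lam, mu). lam \<in> partitions n \<and> mu \<in> partitions n \<and>
                  (unit_transfer lam mu \<or> unit_transfer mu lam)} \<rparr>"

(* Number of arcs of a shortest path; only meaningful if v is reachable from u,
   which always holds in partition_graph n by connected_partition_graph below. *)
definition graph_dist :: "('a, 'b) pre_digraph \<Rightarrow> 'a \<Rightarrow> 'a \<Rightarrow> nat" where
  "graph_dist G u v = (LEAST k. \<exists>p. pre_digraph.apath G u p v \<and> length p = k)"

(* Only meaningful for finite nonempty S. *)
definition set_dist :: "('a, 'b) pre_digraph \<Rightarrow> 'a set \<Rightarrow> 'a \<Rightarrow> nat" where
  "set_dist G S u = Min (graph_dist G u ` S)"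

lemma finite_partitions: "finite (partitions n)"
proof (rule finite_subset)
  show "partitions n \<subseteq> {xs. set xs \<subseteq> {..n} \<and> length xs \<le> n}"
  proof safe
    fix xs x assume xs: "xs \<in> partitions n"
    show "x \<le> n" if "x \<in> set xs"
      using xs that member_le_sum_list by (auto simp: partitions_def)
    have "(\<forall>x\<in>set xs. 0 < x) \<Longrightarrow> length xs \<le> sum_list xs" for xs :: "nat list"
      by (induction xs) auto
    then show "length xs \<le> n" using xs by (auto simp: partitions_def)
  qed
  show "finite {xs. set xs \<subseteq> {..n} \<and> length xs \<le> n}"
    by (rule finite_lists_length_le) simp
qed

lemma pair_graph_partition_graph: "pair_graph (partition_graph n)"
proof
  show "finite (parcs (partition_graph n))"
    by (rule finite_subset[of _ "partitions n \<times> partitions n"])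
       (auto simp: partition_graph_def finite_partitions)
  show "symmetric (partition_graph n)"
    by (auto simp: symmetric_def sym_def partition_graph_def)
qed (auto simp: partition_graph_def finite_partitions unit_transfer_def)

lemma pverts_partition_graph [simp]: "pverts (partition_graph n) = partitions n"
  by (simp add: partition_graph_def)

lemma rev_sort_id: "sorted_wrt (\<ge>) xs \<Longrightarrow> rev (sort xs) = xs" for xs :: "nat list"
proof -
  assume "sorted_wrt (\<ge>) xs"
  then have "sorted (rev xs)" by (simp add: sorted_wrt_rev)
  then have "sort (rev xs) = rev xs" by (rule sorted_sort_id)
  moreover have "sort (rev xs) = sort xs" by (rule properties_for_sort) simp_all
  ultimately show ?thesis by simp
qed

lemma reachable_one_part:
  assumes "lam \<in> partitions n" "n \<ge> 1"
  shows "lam \<rightarrow>\<^sup>*\<^bsub>partition_graph n\<^esub> [n]"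
  using assms(1)
proof (induction "n - hd lam" arbitrary: lam rule: less_induct)
  case less
  interpret G: pair_graph "partition_graph n" by (rule pair_graph_partition_graph)
  have "lam \<noteq> []" using less.prems assms(2) by (auto simp: partitions_def)
  then obtain a xs where lam: "lam = a # xs" by (cases lam) auto
  show ?case
  proof (cases "xs = []")
    case True
    then have "lam = [n]" using less.prems lam by (auto simp: partitions_def)
    then show ?thesis
      using less.prems G.reachable_refl by simp
  next
    case False
    then obtain ys b where "xs = ys @ [b]" by (metis rev_exhaust)
    then have lam: "lam = a # ys @ [b]" using lam by simp
    define mu where "mu = (a + 1) # ys @ filter (\<lambda>x. x \<noteq> 0) [b - 1]"
    have mu: "mu \<in> partitions n"
      using less.prems by (auto simp: partitions_def mu_def lam sorted_wrt_append)
    have "lam[0 := lam ! 0 + 1, length ys + 1 := lam ! (length ys + 1) - 1] = (a + 1) # ys @ [b - 1]"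
      by (simp add: lam nth_append list_update_append)
    moreover have "filter (\<lambda>x. x \<noteq> 0) ((a + 1) # ys @ [b - 1]) = mu"
    proof -
      have "filter (\<lambda>x. x \<noteq> 0) ys = ys"
        using less.prems by (intro filter_True) (auto simp: partitions_def lam)
      then show ?thesis by (simp add: mu_def)
    qed
    moreover have "rev (sort mu) = mu"
      using mu by (intro rev_sort_id) (auto simp: partitions_def)
    ultimately have eq: "mu = rev (sort (filter (\<lambda>x. x \<noteq> 0)
        (lam[0 := lam ! 0 + 1, length ys + 1 := lam ! (length ys + 1) - 1])))" by metis
    have "0 < length lam" "length ys + 1 < length lam" "0 \<noteq> length ys + 1" "mu \<noteq> lam"
      by (auto simp: lam mu_def)
    with eq have "unit_transfer lam mu" unfolding unit_transfer_def by blast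
    then have "(lam, mu) \<in> parcs (partition_graph n)"
      using less.prems mu by (auto simp: partition_graph_def)
    moreover have "mu \<rightarrow>\<^sup>*\<^bsub>partition_graph n\<^esub> [n]"
    proof (rule less.hyps[OF _ mu])
      have "b > 0" "a + sum_list ys + b = n" using less.prems by (auto simp: partitions_def lam)
      then show "n - hd mu < n - hd lam" by (simp add: mu_def lam)
    qed
    ultimately show ?thesis using G.adj_reachable_trans by auto
  qed
qed

lemma connected_partition_graph:
  assumes "n \<ge> 1"
  shows "connected (partition_graph n)"
proof -
  interpret G: pair_graph "partition_graph n" by (rule pair_graph_partition_graph)
  have "strongly_connected (partition_graph n)"
    unfolding strongly_connected_def
  proof (intro conjI ballI)
    have "[n] \<in> partitions n" using assms by (simp add: partitions_def)
    then show "verts (partition_graph n) \<noteq> {}" by (auto simp: partition_graph_def)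
  next
    fix u v assume "u \<in> verts (partition_graph n)" "v \<in> verts (partition_graph n)"
    then have "u \<rightarrow>\<^sup>*\<^bsub>partition_graph n\<^esub> [n]" "v \<rightarrow>\<^sup>*\<^bsub>partition_graph n\<^esub> [n]"
      using assms by (auto intro!: reachable_one_part)
    then show "u \<rightarrow>\<^sup>*\<^bsub>partition_graph n\<^esub> v"
      using symmetric_reachable G.sym_arcs G.reachable_trans by metis
  qed
  moreover have "verts (mk_symmetric (with_proj (partition_graph n))) = verts (with_proj (partition_graph n))"
    by (simp add: mk_symmetric_def)
  ultimately show ?thesis
    unfolding connected_def strongly_connected_def by (metis G.reachable_mk_symmetricI)
qed

end

theory Submission
  imports Defs
begin

text \<open>
  Prefixing a shortest path from \<open>mu\<close> to a vertex \<open>s\<close> by the arc from \<open>lam\<close> to \<open>mu\<close> gives a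
  walk from \<open>lam\<close> to \<open>s\<close> that is one arc longer, so the distance to \<open>s\<close> is at most one larger at
  \<open>lam\<close> than at \<open>mu\<close>. Taking \<open>s \<in> S\<close> nearest to \<open>mu\<close> carries this bound over to the distance to
  \<open>S\<close>, and the graph is symmetric, so \<open>lam\<close> and \<open>mu\<close> may be exchanged. An integer of absolute
  value at most one is \<open>-1\<close>, \<open>0\<close> or \<open>1\<close>, which yields the three cases.

  Since distance is measured along paths and not along walks, and the prefixed walk visits
  \<open>lam\<close> twice if the shortest path runs through it, walks have to be shortened to paths
  (\<open>awalk_imp_apath_length_le\<close>). The least length defining the distance is attained because
  the partition graph is connected.
\<close>

text \<open>Cutting a cycle out of a walk shortens it, and once no cycle is left the walk is a path.\<close>

lemma (in wf_digraph) awalk_imp_apath_length_le: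
  assumes "awalk u p v"
  shows "\<exists>q. apath u q v \<and> length q \<le> length p"
  using assms
proof (induction rule: awalk_to_apath_induct)
  case (path p)
  then show ?case by (auto simp: apath_def)
next
  case (decomp p q r s)
  have "p = q @ r @ s"
    using awalk_cyc_decomp_has_prop[OF decomp(1,3)] decomp(2) by auto
  with decomp(4) show ?case by auto
qed

lemma (in wf_digraph) graph_dist_le_length_awalk:
  assumes "awalk u p v"
  shows "graph_dist G u v \<le> length p"
proof -
  obtain q where q: "apath u q v" "length q \<le> length p"
    using awalk_imp_apath_length_le[OF assms] by blast
  have "graph_dist G u v \<le> length q"
    unfolding graph_dist_def using q(1) by (blast intro: Least_le)
  with q(2) show ?thesis by simp
qed

lemma (in wf_digraph) shortest_apath:
  assumes "u \<rightarrow>\<^sup>* v"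
  obtains p where "apath u p v" "length p = graph_dist G u v"
proof -
  have "\<exists>k p. apath u p v \<and> length p = k"
    using assms by (auto simp: reachable_awalk dest: awalk_imp_apath_length_le)
  then have "\<exists>p. apath u p v \<and> length p = graph_dist G u v"
    unfolding graph_dist_def by (rule LeastI_ex)
  with that show thesis by blast
qed

lemma (in wf_digraph) graph_dist_tail_le_Suc_head:
  assumes "e \<in> arcs G" "head G e \<rightarrow>\<^sup>* s"
  shows "graph_dist G (tail G e) s \<le> Suc (graph_dist G (head G e) s)"
proof -
  obtain p where p: "apath (head G e) p s" "length p = graph_dist G (head G e) s"
    using assms(2) by (rule shortest_apath)
  have "awalk (tail G e) (e # p) s"
    using assms(1) p(1) by (simp add: awalk_Cons_iff awalkI_apath)
  from graph_dist_le_length_awalk[OF this] p(2) show ?thesis by simp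
qed

text \<open>
  The vertex of \<open>S\<close> nearest to the head of an arc need not be the one nearest to its tail, but its
  distance from the tail is still an upper bound for the minimum there.
\<close>

lemma (in wf_digraph) set_dist_tail_le_Suc_head:
  assumes "e \<in> arcs G" "finite S" "S \<noteq> {}" "\<And>s. s \<in> S \<Longrightarrow> head G e \<rightarrow>\<^sup>* s"
  shows "set_dist G S (tail G e) \<le> Suc (set_dist G S (head G e))"
proof -
  have "set_dist G S (head G e) \<in> graph_dist G (head G e) ` S"
    unfolding set_dist_def using assms(2,3) by (intro Min_in) auto
  then obtain s where s: "s \<in> S" "set_dist G S (head G e) = graph_dist G (head G e) s"
    by blast
  have "set_dist G S (tail G e) \<le> graph_dist G (tail G e) s"
    unfolding set_dist_def using assms(2) s(1) by (intro Min_le) auto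
  also have "\<dots> \<le> Suc (graph_dist G (head G e) s)"
    using assms(1,4) s(1) by (intro graph_dist_tail_le_Suc_head) auto
  finally show ?thesis using s(2) by simp
qed

lemma reachable_partition_graph:
  assumes "n \<ge> 1" "lam \<in> partitions n" "mu \<in> partitions n"
  shows "lam \<rightarrow>\<^sup>*\<^bsub>partition_graph n\<^esub> mu"
proof -
  interpret G: pair_graph "partition_graph n" by (rule pair_graph_partition_graph)
  have "strongly_connected (partition_graph n)"
    using connected_partition_graph[OF assms(1)] G.sym_arcs
    by (rule G.symmetric_connected_imp_strongly_connected[rotated])
  with assms(2,3) show ?thesis by auto
qed

lemma set_dist_partition_graph_le_Suc:
  assumes "n \<ge> 1" "S \<subseteq> partitions n" "S \<noteq> {}" "(lam, mu) \<in> parcs (partition_graph n)"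
  shows "set_dist (partition_graph n) S lam \<le> Suc (set_dist (partition_graph n) S mu)"
proof -
  interpret G: pair_graph "partition_graph n" by (rule pair_graph_partition_graph)
  have "finite S"
    using assms(2) finite_partitions by (rule finite_subset)
  moreover have "mu \<in> partitions n"
    using assms(4) by (simp add: partition_graph_def)
  ultimately show ?thesis
    using G.set_dist_tail_le_Suc_head[of "(lam, mu)" S] assms reachable_partition_graph
    by auto
qed

theorem proposition3p1:
  fixes n :: nat and S :: "nat list set" and lam mu :: "nat list"
  defines "d \<equiv> \<lambda>x. int (set_dist (partition_graph n) S x)"
  assumes "n \<ge> 1"
    and "S \<subseteq> pverts (partition_graph n)" and "S \<noteq> {}"
    and "(lam, mu) \<in> parcs (partition_graph n)"
  shows "\<bar>d lam - d mu\<bar> \<le> 1 \<and>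
    (\<bar>d lam - d mu\<bar> \<le> 1 \<longleftrightarrow>
       (d mu = d lam - 1 \<and> d mu \<noteq> d lam \<and> d mu \<noteq> d lam + 1) \<or>
       (d mu \<noteq> d lam - 1 \<and> d mu = d lam \<and> d mu \<noteq> d lam + 1) \<or>
       (d mu \<noteq> d lam - 1 \<and> d mu \<noteq> d lam \<and> d mu = d lam + 1))"
proof -
  have "(mu, lam) \<in> parcs (partition_graph n)"
    using assms(5) by (auto simp: partition_graph_def)
  with assms(2-5) have "d mu \<le> d lam + 1" "d lam \<le> d mu + 1"
    using set_dist_partition_graph_le_Suc[of n S lam mu]
      set_dist_partition_graph_le_Suc[of n S mu lam]
    by (auto simp: d_def)
  then show ?thesis by linarith
qed

end
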